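(* Let $X$ be a nonempty, at most countable set and let $w=\{w_{xy}\mid x,y\in X\}$ be a family of symmetric lower semicontinuous convex functions $w_{xy}\colon\mathbb R\to[0,\infty]$ with $w_{xy}(0)=0$ and $w_{xy}=w_{yx}$ for all $x,y\in X$. Define $$\mathcal E_w\colon\mathcal F(X)\to[0,\infty],\qquad\mathcal E_w(f)=\sum_{x,y\in X}w_{xy}(f(x)-f(y)).$$ Then $\mathcal E_w$ is convex, symmetric and lower semicontinuous. Moreover, all normal contractions operate on $\mathcal E_w$.
   Context: $\mathcal F(X)$ is the real vector space of all functions $f\colon X\to\mathbb R$, equipped with the topology of pointwise convergence. A function $h\colon V\to[0,\infty]$ on a real vector space $V$ is symmetric if $h(v)=h(-v)$ for all $v\in V$. $\mathcal E$ is lower semicontinuous if $\mathcal E(f)\le\liminf_i\mathcal E(f_i)$ for every net $(f_i)$ converging pointwise to $f$. A normal contraction is a $1$-Lipschitz function $C\colon\mathbb R\to\mathbb R$ with $C(0)=0$; it operates on $\mathcal E$ if $\mathcal E(f+C\circ g)+\mathcal E(f-C\circ g)\le\mathcal E(f+g)+\mathcal E(f-g)$ for all $f,g\in\mathcal F(X)$. *)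

theory Defs
  imports "HOL-Analysis.Analysis" "HOL-Library.Function_Algebras"
begin

text \<open>
  The space of all functions \<open>X \<rightarrow> \<real>\<close> is the function type \<open>'x \<Rightarrow> real\<close>. Its additive structure
  comes from \<open>Function_Algebras\<close>, its topology (product topology, i.e. pointwise convergence) from
  \<open>Function_Topology\<close>; the scalar multiplication is not in the library.
\<close>

instantiation "fun" :: (type, real_vector) real_vector
begin

definition scaleR_fun :: "real \<Rightarrow> ('a \<Rightarrow> 'b) \<Rightarrow> 'a \<Rightarrow> 'b" where
  "scaleR_fun r f = (\<lambda>x. r *\<^sub>R f x)"

instance
  by standard (auto simp: scaleR_fun_def fun_eq_iff scaleR_add_right scaleR_add_left)

end

definition symmetric_fun :: "('v::real_vector \<Rightarrow> ennreal) \<Rightarrow> bool" where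
  "symmetric_fun h \<longleftrightarrow> (\<forall>v. h v = h (- v))"

text \<open>
  The library's \<open>convex_on\<close> is restricted to real-valued functions. Note that \<open>0 * \<infinity> = 0\<close>
  in \<open>ennreal\<close>; the instances with a zero coefficient are trivial in either reading.
\<close>

definition convex_fun :: "('v::real_vector \<Rightarrow> ennreal) \<Rightarrow> bool" where
  "convex_fun h \<longleftrightarrow> (\<forall>x y a b. a \<ge> 0 \<longrightarrow> b \<ge> 0 \<longrightarrow> a + b = 1 \<longrightarrow>
     h (a *\<^sub>R x + b *\<^sub>R y) \<le> ennreal a * h x + ennreal b * h y)"

text \<open>
  Nets are represented by filters on the space: a net \<open>g\<close> along a directed set corresponds to the
  image filter \<open>F\<close> of its tails, it converges to \<open>v\<close> iff \<open>F \<le> nhds v\<close>, and its limes inferior is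
  \<open>Liminf F h\<close>. This avoids fixing an index type for nets inside the definition; see
  \<open>lower_semicontinuous_net\<close> and \<open>lower_semicontinuous_if_nets\<close> below.
\<close>

definition lower_semicontinuous :: "('v::topological_space \<Rightarrow> ennreal) \<Rightarrow> bool" where
  "lower_semicontinuous h \<longleftrightarrow> (\<forall>v F. F \<le> nhds v \<longrightarrow> h v \<le> Liminf F h)"

definition directed :: "'i set \<Rightarrow> ('i \<Rightarrow> 'i \<Rightarrow> bool) \<Rightarrow> bool" where
  "directed I r \<longleftrightarrow> I \<noteq> {} \<and> reflp_on I r \<and> transp_on I r \<and>
     (\<forall>i\<in>I. \<forall>j\<in>I. \<exists>k\<in>I. r i k \<and> r j k)"

definition net_converges ::
  "'i set \<Rightarrow> ('i \<Rightarrow> 'i \<Rightarrow> bool) \<Rightarrow> ('i \<Rightarrow> 'v::topological_space) \<Rightarrow> 'v \<Rightarrow> bool" where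
  "net_converges I r g v \<longleftrightarrow>
     (\<forall>U. open U \<longrightarrow> v \<in> U \<longrightarrow> (\<exists>i\<in>I. \<forall>j\<in>I. r i j \<longrightarrow> g j \<in> U))"

definition net_liminf ::
  "'i set \<Rightarrow> ('i \<Rightarrow> 'i \<Rightarrow> bool) \<Rightarrow> ('i \<Rightarrow> ennreal) \<Rightarrow> ennreal" where
  "net_liminf I r a = (SUP i\<in>I. INF j\<in>{j \<in> I. r i j}. a j)"

lemma lower_semicontinuous_net:
  assumes h: "lower_semicontinuous h" and I: "directed I r" and g: "net_converges I r g v"
  shows "h v \<le> net_liminf I r (\<lambda>i. h (g i))"
proof -
  define F where "F = (INF i\<in>I. principal (g ` {j \<in> I. r i j}))"
  have ev: "eventually P F \<longleftrightarrow> (\<exists>i\<in>I. \<forall>j\<in>I. r i j \<longrightarrow> P (g j))" for P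
    unfolding F_def
  proof (subst eventually_INF_base)
    show "I \<noteq> {}" using I by (simp add: directed_def)
    fix a b assume ab: "a \<in> I" "b \<in> I"
    then obtain k where k: "k \<in> I" "r a k" "r b k" using I unfolding directed_def by blast
    have "r a j \<and> r b j" if "j \<in> I" "r k j" for j
      using I ab k that unfolding directed_def by (meson transp_onD)
    then show "\<exists>x\<in>I. principal (g ` {j \<in> I. r x j}) \<le>
        inf (principal (g ` {j \<in> I. r a j})) (principal (g ` {j \<in> I. r b j}))"
      using k by auto
  qed (auto simp: eventually_principal)
  have "F \<le> nhds v"
    unfolding le_filter_def eventually_nhds ev using g unfolding net_converges_def by meson
  then have "h v \<le> Liminf F h" using h by (simp add: lower_semicontinuous_def)
  also have "\<dots> \<le> net_liminf I r (\<lambda>i. h (g i))"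
    unfolding Liminf_def
  proof (rule SUP_least)
    fix P assume "P \<in> {P. eventually P F}"
    then obtain i where i: "i \<in> I" "\<forall>j\<in>I. r i j \<longrightarrow> P (g j)" using ev by auto
    have "(INF x\<in>Collect P. h x) \<le> (INF j\<in>{j \<in> I. r i j}. h (g j))"
      using i by (intro INF_greatest INF_lower) auto
    also have "\<dots> \<le> net_liminf I r (\<lambda>i. h (g i))"
      unfolding net_liminf_def using i(1) by (rule SUP_upper)
    finally show "(INF x\<in>Collect P. h x) \<le> net_liminf I r (\<lambda>i. h (g i))" .
  qed
  finally show ?thesis .
qed

lemma lower_semicontinuous_if_nets:
  fixes h :: "'v::topological_space \<Rightarrow> ennreal"
  assumes nets: "\<And>(I :: ('v set \<times> 'v) set) r g v. directed I r \<Longrightarrow> net_converges I r g v \<Longrightarrow>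
    h v \<le> net_liminf I r (\<lambda>i. h (g i))"
  shows "lower_semicontinuous h"
  unfolding lower_semicontinuous_def
proof (intro allI impI)
  fix v :: 'v and F assume F: "F \<le> nhds v"
  define I :: "('v set \<times> 'v) set" where "I = {(U, y). open U \<and> v \<in> U \<and> y \<in> U}"
  define r where "r = (\<lambda>(i :: 'v set \<times> 'v) (j :: 'v set \<times> 'v). fst j \<subseteq> fst i)"
  have "\<exists>k\<in>I. r i k \<and> r j k" if "i \<in> I" "j \<in> I" for i j
    using that by (intro bexI[of _ "(fst i \<inter> fst j, v)"]) (auto simp: I_def r_def)
  moreover have "(UNIV, v) \<in> I" by (simp add: I_def)
  ultimately have "directed I r"
    unfolding directed_def by (auto simp: r_def intro!: reflp_onI transp_onI)
  moreover have "net_converges I r snd v"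
    unfolding net_converges_def
  proof (intro allI impI)
    fix U :: "'v set" assume "open U" "v \<in> U"
    then show "\<exists>i\<in>I. \<forall>j\<in>I. r i j \<longrightarrow> snd j \<in> U"
      by (intro bexI[of _ "(U, v)"]) (auto simp: I_def r_def)
  qed
  ultimately have "h v \<le> net_liminf I r (\<lambda>i. h (snd i))" by (rule nets)
  also have "\<dots> \<le> Liminf F h"
    unfolding net_liminf_def
  proof (rule SUP_least)
    fix i assume "i \<in> I"
    then have U: "open (fst i)" "v \<in> fst i" by (auto simp: I_def)
    then have "eventually (\<lambda>y. y \<in> fst i) F"
      by (intro filter_leD[OF F] eventually_nhds_in_open)
    moreover have "(INF j\<in>{j \<in> I. r i j}. h (snd j)) \<le> (INF y\<in>{y. y \<in> fst i}. h y)"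
    proof (rule INF_greatest)
      fix y assume "y \<in> {y. y \<in> fst i}"
      then have "(fst i, y) \<in> {j \<in> I. r i j}" using U by (auto simp: I_def r_def)
      then show "(INF j\<in>{j \<in> I. r i j}. h (snd j)) \<le> h y" by (rule INF_lower2) simp
    qed
    ultimately show "(INF j\<in>{j \<in> I. r i j}. h (snd j)) \<le> Liminf F h"
      unfolding Liminf_def by (intro SUP_upper2[of "\<lambda>y. y \<in> fst i"]) auto
  qed
  finally show "h v \<le> Liminf F h" .
qed

definition normal_contraction :: "(real \<Rightarrow> real) \<Rightarrow> bool" where
  "normal_contraction C \<longleftrightarrow> 1-lipschitz_on UNIV C \<and> C 0 = 0"

definition operates_on :: "(real \<Rightarrow> real) \<Rightarrow> (('x \<Rightarrow> real) \<Rightarrow> ennreal) \<Rightarrow> bool" where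
  "operates_on C E \<longleftrightarrow> (\<forall>f g. E (f + (C \<circ> g)) + E (f - (C \<circ> g)) \<le> E (f + g) + E (f - g))"

text \<open>The sum always exists, since its terms lie in \<open>[0, \<infinity>]\<close>.\<close>

definition energy :: "('x \<Rightarrow> 'x \<Rightarrow> real \<Rightarrow> ennreal) \<Rightarrow> ('x \<Rightarrow> real) \<Rightarrow> ennreal" where
  "energy w f = (\<Sum>\<^sub>\<infinity>(x, y)\<in>UNIV. w x y (f x - f y))"

end

theory Submission
  imports Defs
begin

text \<open>
  Convexity, lower semicontinuity and the contraction inequality all pass to sums and to suprema, so
  everything reduces to a single term \<open>w x y\<close>. There the contraction inequality holds because
  \<open>c = C (g x) - C (g y)\<close> satisfies \<open>\<bar>c\<bar> \<le> \<bar>b\<bar>\<close> for \<open>b = g x - g y\<close>, so \<open>a + c\<close> and \<open>a - c\<close> are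
  convex combinations of \<open>a + b\<close> and \<open>a - b\<close> with interchanged weights.
\<close>

text \<open>Two eventual predicates have their conjunction as a common refinement, so the sum of the
  two suprema is a supremum over a single predicate. For each such predicate, the sum of the infima
  bounds every value of the sum from below.\<close>

lemma Liminf_add_ennreal:
  fixes f g :: "'a \<Rightarrow> ennreal"
  shows "Liminf F f + Liminf F g \<le> Liminf F (\<lambda>x. f x + g x)"
proof -
  let ?I = "{P. eventually P F}"
  have "Liminf F f + Liminf F g
      = (SUP P\<in>?I. Inf (f ` Collect P) + Inf (g ` Collect P))"
    unfolding Liminf_def
  proof (rule SUP_add_directed_ennreal[symmetric])
    fix P Q assume "P \<in> ?I" "Q \<in> ?I"
    then show "\<exists>R\<in>?I. Inf (f ` Collect P) + Inf (g ` Collect Q)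
        \<le> Inf (f ` Collect R) + Inf (g ` Collect R)"
      by (intro bexI[of _ "\<lambda>x. P x \<and> Q x"] add_mono INF_superset_mono)
         (auto intro: eventually_conj)
  qed
  also have "\<dots> \<le> Liminf F (\<lambda>x. f x + g x)"
    unfolding Liminf_def
    by (intro SUP_mono') (auto intro!: INF_greatest add_mono INF_lower)
  finally show ?thesis .
qed

lemma lower_semicontinuous_sum:
  fixes h :: "'i \<Rightarrow> 'v::topological_space \<Rightarrow> ennreal"
  assumes "\<And>i. i \<in> A \<Longrightarrow> lower_semicontinuous (h i)"
  shows "lower_semicontinuous (\<lambda>v. \<Sum>i\<in>A. h i v)"
  using assms
\<comment> \<open>For infinite \<open>A\<close> the sum has the default value 0, so this case, like
  the empty one, concerns the constant function 0.\<close>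
proof (induction A rule: infinite_finite_induct)
  case (insert a A)
  show ?case
    unfolding lower_semicontinuous_def
  proof (intro allI impI)
    fix v :: 'v and F assume F: "F \<le> nhds v"
    have "(\<Sum>i\<in>insert a A. h i v) \<le> Liminf F (h a) + Liminf F (\<lambda>v. \<Sum>i\<in>A. h i v)"
      using insert F by (auto simp: lower_semicontinuous_def intro!: add_mono)
    also have "\<dots> \<le> Liminf F (\<lambda>v. \<Sum>i\<in>insert a A. h i v)"
      using Liminf_add_ennreal insert(1,2) by simp
    finally show "(\<Sum>i\<in>insert a A. h i v) \<le> Liminf F (\<lambda>v. \<Sum>i\<in>insert a A. h i v)" .
  qed
qed (auto simp: lower_semicontinuous_def)

lemma lower_semicontinuous_SUP:
  fixes h :: "'i \<Rightarrow> 'v::topological_space \<Rightarrow> ennreal"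
  assumes "\<And>i. i \<in> I \<Longrightarrow> lower_semicontinuous (h i)"
  shows "lower_semicontinuous (\<lambda>v. SUP i\<in>I. h i v)"
  unfolding lower_semicontinuous_def
proof (intro allI impI SUP_least)
  fix v :: 'v and F i assume "F \<le> nhds v" "i \<in> I"
  then have "h i v \<le> Liminf F (h i)"
    using assms by (auto simp: lower_semicontinuous_def)
  also have "\<dots> \<le> Liminf F (\<lambda>v. SUP i\<in>I. h i v)"
    using \<open>i \<in> I\<close> by (intro Liminf_mono always_eventually allI SUP_upper)
  finally show "h i v \<le> Liminf F (\<lambda>v. SUP i\<in>I. h i v)" .
qed

text \<open>Continuity pushes a filter converging to \<open>v\<close> to one converging to
  \<open>g v\<close>, where the hypothesis on \<open>h\<close> applies. For the energy,
  \<open>g\<close> is the evaluation of a function's difference at two points.\<close>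

lemma lower_semicontinuous_compose:
  fixes g :: "'a::topological_space \<Rightarrow> 'b::topological_space"
  assumes h: "lower_semicontinuous h" and g: "continuous_on UNIV g"
  shows "lower_semicontinuous (\<lambda>v. h (g v))"
  unfolding lower_semicontinuous_def
proof (intro allI impI)
  fix v :: 'a and F assume "F \<le> nhds v"
  moreover have "filterlim g (nhds (g v)) (nhds v)"
    using g by (simp add: continuous_on_def tendsto_at_iff_tendsto_nhds)
  ultimately have "filterlim g (nhds (g v)) F"
    by (rule filterlim_mono[OF _ order_refl, rotated])
  then have "h (g v) \<le> Liminf (filtermap g F) h"
    using h by (simp add: lower_semicontinuous_def filterlim_def)
  also have "\<dots> \<le> Liminf F (\<lambda>v. h (g v))" by (rule Liminf_filtermap_le)
  finally show "h (g v) \<le> Liminf F (\<lambda>v. h (g v))" .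
qed

lemma convex_fun_add_diff_le:
  fixes h :: "real \<Rightarrow> ennreal"
  assumes h: "convex_fun h" and cb: "\<bar>c\<bar> \<le> \<bar>b\<bar>"
  shows "h (a + c) + h (a - c) \<le> h (a + b) + h (a - b)"
proof (cases "b = 0")
  case False
  \<comment> \<open>These solve \<open>s + t = 1\<close> and \<open>(s - t) * b = c\<close>; the
    bound on \<open>c\<close> makes both nonnegative. If \<open>b = 0\<close>, then
    \<open>c = 0\<close> and the two sides agree.\<close>
  define s t where "s = (1 + c / b) / 2" and "t = (1 - c / b) / 2"
  have "\<bar>c / b\<bar> \<le> 1" using cb False by (simp add: abs_divide)
  then have st: "0 \<le> s" "0 \<le> t" "s + t = 1"
    unfolding s_def t_def abs_le_iff by (auto simp flip: add_divide_distrib)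
  have "(s - t) * b = c" using False by (simp add: s_def t_def field_simps)
  moreover have "s * (a + b) + t * (a - b) = (s + t) * a + (s - t) * b"
    "t * (a + b) + s * (a - b) = (s + t) * a - (s - t) * b"
    by (simp_all add: algebra_simps)
  ultimately have eq: "s * (a + b) + t * (a - b) = a + c" "t * (a + b) + s * (a - b) = a - c"
    using st by simp_all
  have "h (a + c) \<le> ennreal s * h (a + b) + ennreal t * h (a - b)"
    "h (a - c) \<le> ennreal t * h (a + b) + ennreal s * h (a - b)"
    using h[unfolded convex_fun_def, rule_format, of s t "a + b" "a - b"]
      h[unfolded convex_fun_def, rule_format, of t s "a + b" "a - b"] st eq
    by (simp_all add: add.commute)
  then have "h (a + c) + h (a - c) \<le> (ennreal s * h (a + b) + ennreal t * h (a - b))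
      + (ennreal t * h (a + b) + ennreal s * h (a - b))"
    by (rule add_mono)
  also have "\<dots> = (ennreal s + ennreal t) * h (a + b) + (ennreal s + ennreal t) * h (a - b)"
    by (simp add: algebra_simps)
  also have "ennreal s + ennreal t = 1" using st by (simp flip: ennreal_plus)
  finally show ?thesis by simp
qed (use cb in simp)

text \<open>A sum of nonnegative terms is the supremum of its finite partial sums. Convexity and
  lower semicontinuity are transferred from finite sums through this form.\<close>

lemma energy_eq_SUP:
  "energy w f = (SUP A\<in>Collect finite. \<Sum>(x, y)\<in>A. w x y (f x - f y))"
  unfolding energy_def by (subst nonneg_infsum_complete) auto

lemma sum_le_energy:
  "finite A \<Longrightarrow> (\<Sum>(x, y)\<in>A. w x y (f x - f y)) \<le> energy w f"
  unfolding energy_eq_SUP by (rule SUP_upper) simp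

lemma energy_leI:
  assumes "\<And>A. finite A \<Longrightarrow> (\<Sum>(x, y)\<in>A. w x y (f x - f y)) \<le> c"
  shows "energy w f \<le> c"
  unfolding energy_eq_SUP using assms by (auto intro: SUP_least)

text \<open>Both sides of the contraction inequality are sums of two energies; merging each into one
  sum allows a comparison term by term.\<close>

lemma energy_add:
  "energy w f + energy w g = (\<Sum>\<^sub>\<infinity>(x, y)\<in>UNIV. w x y (f x - f y) + w x y (g x - g y))"
  unfolding energy_def
  by (subst infsum_add[symmetric]) (auto intro!: nonneg_summable_on_complete infsum_cong)

lemma convex_fun_energy:
  assumes "\<And>x y. convex_fun (w x y)"
  shows "convex_fun (energy w)"
  unfolding convex_fun_def
proof (intro allI impI energy_leI)
  fix f g :: "'a \<Rightarrow> real" and a b :: real and A :: "('a \<times> 'a) set"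
  assume ab: "a \<ge> 0" "b \<ge> 0" "a + b = 1" and A: "finite A"
  let ?h = "a *\<^sub>R f + b *\<^sub>R g"
  \<comment> \<open>Taking differences is linear, so \<open>?h x - ?h y\<close> is the same convex
    combination of the differences of \<open>f\<close> and \<open>g\<close>.\<close>
  have "w x y (?h x - ?h y) \<le> ennreal a * w x y (f x - f y) + ennreal b * w x y (g x - g y)" for x y
    using assms[unfolded convex_fun_def, rule_format, OF ab, of x y "f x - f y" "g x - g y"]
    by (simp add: scaleR_fun_def algebra_simps)
  then have "(\<Sum>(x, y)\<in>A. w x y (?h x - ?h y))
      \<le> (\<Sum>(x, y)\<in>A. ennreal a * w x y (f x - f y) + ennreal b * w x y (g x - g y))"
    by (intro sum_mono) auto
  also have "\<dots> = ennreal a * (\<Sum>(x, y)\<in>A. w x y (f x - f y))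
      + ennreal b * (\<Sum>(x, y)\<in>A. w x y (g x - g y))"
    by (simp add: sum.distrib sum_distrib_left case_prod_beta)
  also have "\<dots> \<le> ennreal a * energy w f + ennreal b * energy w g"
    using A by (intro add_mono mult_left_mono sum_le_energy) auto
  finally show "(\<Sum>(x, y)\<in>A. w x y (?h x - ?h y)) \<le> ennreal a * energy w f + ennreal b * energy w g" .
qed

lemma symmetric_fun_energy:
  assumes "\<And>x y. symmetric_fun (w x y)"
  shows "symmetric_fun (energy w)"
proof -
  \<comment> \<open>The difference \<open>f y - f x\<close> is the one that \<open>- f\<close> has
    at \<open>(x, y)\<close>, so the two energies agree term by term.\<close>
  have "w x y (f x - f y) = w x y (f y - f x)" for f :: "'a \<Rightarrow> real" and x y
    using assms[unfolded symmetric_fun_def, rule_format, of x y "f x - f y"] by simp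
  then show ?thesis
    unfolding symmetric_fun_def energy_def by (auto intro!: infsum_cong)
qed

lemma lower_semicontinuous_energy:
  assumes "\<And>x y. lower_semicontinuous (w x y)"
  shows "lower_semicontinuous (energy w)"
  unfolding energy_eq_SUP[abs_def] case_prod_beta
  \<comment> \<open>Each map sending \<open>f\<close> to \<open>f x - f y\<close> is continuous for
    pointwise convergence.\<close>
  by (intro lower_semicontinuous_SUP lower_semicontinuous_sum
      lower_semicontinuous_compose[OF assms] continuous_intros) auto

lemma operates_on_energy:
  assumes w: "\<And>x y. convex_fun (w x y)" and C: "1-lipschitz_on UNIV C"
  shows "operates_on C (energy w)"
  unfolding operates_on_def energy_add
proof (intro allI infsum_mono nonneg_summable_on_complete)
  fix f g :: "'a \<Rightarrow> real" and p :: "'a \<times> 'a"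
  obtain x y where p: "p = (x, y)" by fastforce
  have "\<bar>C (g x) - C (g y)\<bar> \<le> \<bar>g x - g y\<bar>"
    using lipschitz_onD[OF C, of "g x" "g y"] by (simp add: dist_real_def)
  from convex_fun_add_diff_le[OF w this, of x y "f x - f y"]
  show "(case p of (x, y) \<Rightarrow> w x y ((f + (C \<circ> g)) x - (f + (C \<circ> g)) y)
        + w x y ((f - (C \<circ> g)) x - (f - (C \<circ> g)) y))
      \<le> (case p of (x, y) \<Rightarrow> w x y ((f + g) x - (f + g) y) + w x y ((f - g) x - (f - g) y))"
    by (simp add: p algebra_simps)
qed auto

theorem proposition5p2:
  fixes w :: "'x::countable \<Rightarrow> 'x \<Rightarrow> real \<Rightarrow> ennreal"
  assumes "\<And>x y. symmetric_fun (w x y)"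
    and "\<And>x y. lower_semicontinuous (w x y)"
    and "\<And>x y. convex_fun (w x y)"
    and "\<And>x y. w x y 0 = 0"
    and "\<And>x y. w x y = w y x"
  shows "convex_fun (energy w) \<and> symmetric_fun (energy w) \<and> lower_semicontinuous (energy w) \<and>
    (\<forall>C. normal_contraction C \<longrightarrow> operates_on C (energy w))"
  using assms by (auto simp: normal_contraction_def intro!: convex_fun_energy symmetric_fun_energy
      lower_semicontinuous_energy operates_on_energy)

end
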